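(* Consider the following ten properties of simplicial complexes: E-, mid-, weakly-, very-weakly-, clique-chordal, and skeleton-E-, skeleton-mid-, skeleton-weakly-, skeleton-very-weakly-, skeleton-clique-chordal. The following implications hold for all simplicial complexes: (1) skeleton-E $\Rightarrow$ skeleton-mid $\Rightarrow$ skeleton-weakly $\Rightarrow$ skeleton-very-weakly $\Rightarrow$ skeleton-clique; (2) E $\Rightarrow$ mid $\Rightarrow$ weakly $\Rightarrow$ very-weakly; (3) mid $\Rightarrow$ clique; (4) skeleton-$X$ $\Rightarrow$ $X$, for each $X\in\{\text{E, mid, weakly, very-weakly, clique}\}$. Moreover this list is maximal up to transitivity: for every dimension $d\ge 2$, and for every ordered pair $(P,Q)$ of distinct properties among the ten such that $P\Rightarrow Q$ does not follow from (1)–(4) by transitivity, there is a $d$-dimensional simplicial complex that satisfies $P$ but not $Q$.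
   Context: Simplicial complexes are finite and not necessarily pure. A vertex labeling of a complex with $n$ vertices is a bijection of its vertices with $[n]$; $\max F$ is the largest label in $F$; the size of a face is its number of vertices. Two faces of the same dimension $k$ are adjacent if their intersection has dimension $k-1$. A complex $\Delta$ is: - E-chordal, if it has a labeling such that for every two facets $F\ne G$ with the same size and same maximum, every subset $H\subseteq F\cup G$ with $|H|=|F|$ is a face of $\Delta$; - mid-chordal, if it has a labeling such that for every two facets $F\neq G$ with the same size and same maximum, $\Delta$ contains every $2$-element subset $e$ of $(F\cup G)\setminus\{\max F\}$ and, for each such $e$, some face $H_e$ with $|H_e|=|F|$ and $e\subseteq H_e\subseteq (F\cup G)\setminus\{\max F\}$; - weakly-chordal, if it has a labeling such that for every two facets $F\ne G$ with the same size and same maximum, $\Delta$ contains some face $H$ with $|H|=|F|$ and $H\subseteq (F\cup G)\setminus\{\max F\}$; - very-weakly-chordal, if it has a labeling such that for every two adjacent facets $F\ne G$ with the same size and same maximum, $(F\cup G)\setminus\{\max F\}$ is a face of $\Delta$; - clique-chordal, if it has a labeling such that for every two facets $F\ne G$ with the same size and same maximum, every $2$-element subset of $F\cup G$ is a face of $\Delta$. The properties skeleton-E-, skeleton-mid-, skeleton-weakly-, skeleton-very-weakly-, skeleton-clique-chordal are defined in the same way, replacing "every two (adjacent) facets $F\ne G$" by "every two (adjacent) faces $f\neq g$ of $\Delta$" (with size $\ge 2$ in the mid and clique cases), with a single labeling working for faces of all sizes. *)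

theory Defs
  imports Main
begin

text \<open>Finite abstract simplicial complexes. The vertices of a complex are the elements of its
  faces, so there are no ghost vertices; the empty set is a face (of dimension \<open>-1\<close>).\<close>

definition abstract_complex :: "'a set set \<Rightarrow> bool" where
  "abstract_complex K \<longleftrightarrow>
     finite K \<and> (\<forall>F\<in>K. finite F) \<and> {} \<in> K \<and> (\<forall>F\<in>K. \<forall>G. G \<subseteq> F \<longrightarrow> G \<in> K)"

definition vertices :: "'a set set \<Rightarrow> 'a set" where
  "vertices K = \<Union>K"

definition facets :: "'a set set \<Rightarrow> 'a set set" where
  "facets K = {F \<in> K. \<forall>G\<in>K. F \<subseteq> G \<longrightarrow> G = F}"

definition face_dim :: "'a set \<Rightarrow> int" where
  "face_dim F = int (card F) - 1"

definition complex_dim :: "'a set set \<Rightarrow> int" where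
  "complex_dim K = Max (face_dim ` K)"

definition adjacent :: "'a set \<Rightarrow> 'a set \<Rightarrow> bool" where
  "adjacent F G \<longleftrightarrow> face_dim F = face_dim G \<and> face_dim (F \<inter> G) = face_dim F - 1"

definition labeling :: "'a set set \<Rightarrow> ('a \<Rightarrow> nat) \<Rightarrow> bool" where
  "labeling K l \<longleftrightarrow> bij_betw l (vertices K) {1..card (vertices K)}"

definition max_label :: "('a \<Rightarrow> nat) \<Rightarrow> 'a set \<Rightarrow> nat" where
  "max_label l F = Max (l ` F)"

text \<open>\<open>F \<union> G\<close> without the vertex carrying the largest label of \<open>F\<close>.\<close>

definition union_minus_max :: "('a \<Rightarrow> nat) \<Rightarrow> 'a set \<Rightarrow> 'a set \<Rightarrow> 'a set" where
  "union_minus_max l F G = {v \<in> F \<union> G. l v \<noteq> max_label l F}"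

text \<open>Distinct sets of the same size and with the same maximum. Such sets automatically have
  at least two elements if they are faces of a labeled complex, so the value of
  \<^const>\<open>max_label\<close> at the empty set is irrelevant.\<close>

definition comparable :: "('a \<Rightarrow> nat) \<Rightarrow> 'a set \<Rightarrow> 'a set \<Rightarrow> bool" where
  "comparable l F G \<longleftrightarrow> F \<noteq> G \<and> card F = card G \<and> max_label l F = max_label l G"

text \<open>In the following five conditions, \<open>S\<close> is the set of faces of \<open>K\<close> over which the two faces
  \<open>F\<close> and \<open>G\<close> range.\<close>

definition E_chordal_on :: "'a set set \<Rightarrow> 'a set set \<Rightarrow> bool" where
  "E_chordal_on S K \<longleftrightarrow>
     (\<exists>l. labeling K l \<and>
       (\<forall>F\<in>S. \<forall>G\<in>S. comparable l F G \<longrightarrow>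
         (\<forall>H. H \<subseteq> F \<union> G \<and> card H = card F \<longrightarrow> H \<in> K)))"

definition mid_chordal_on :: "'a set set \<Rightarrow> 'a set set \<Rightarrow> bool" where
  "mid_chordal_on S K \<longleftrightarrow>
     (\<exists>l. labeling K l \<and>
       (\<forall>F\<in>S. \<forall>G\<in>S. comparable l F G \<longrightarrow>
         (\<forall>e. e \<subseteq> union_minus_max l F G \<and> card e = 2 \<longrightarrow>
           e \<in> K \<and> (\<exists>H\<in>K. card H = card F \<and> e \<subseteq> H \<and> H \<subseteq> union_minus_max l F G))))"

definition weakly_chordal_on :: "'a set set \<Rightarrow> 'a set set \<Rightarrow> bool" where
  "weakly_chordal_on S K \<longleftrightarrow>
     (\<exists>l. labeling K l \<and>
       (\<forall>F\<in>S. \<forall>G\<in>S. comparable l F G \<longrightarrow>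
         (\<exists>H\<in>K. card H = card F \<and> H \<subseteq> union_minus_max l F G)))"

definition very_weakly_chordal_on :: "'a set set \<Rightarrow> 'a set set \<Rightarrow> bool" where
  "very_weakly_chordal_on S K \<longleftrightarrow>
     (\<exists>l. labeling K l \<and>
       (\<forall>F\<in>S. \<forall>G\<in>S. adjacent F G \<and> comparable l F G \<longrightarrow>
         union_minus_max l F G \<in> K))"

definition clique_chordal_on :: "'a set set \<Rightarrow> 'a set set \<Rightarrow> bool" where
  "clique_chordal_on S K \<longleftrightarrow>
     (\<exists>l. labeling K l \<and>
       (\<forall>F\<in>S. \<forall>G\<in>S. comparable l F G \<longrightarrow>
         (\<forall>e. e \<subseteq> F \<union> G \<and> card e = 2 \<longrightarrow> e \<in> K)))"

datatype chordality = EC | Mid | Weakly | Very_Weakly | Clique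

datatype chordal_property = Facet chordality | Skeleton chordality

fun has_property :: "chordal_property \<Rightarrow> 'a set set \<Rightarrow> bool" where
  "has_property (Facet EC) K = E_chordal_on (facets K) K"
| "has_property (Facet Mid) K = mid_chordal_on (facets K) K"
| "has_property (Facet Weakly) K = weakly_chordal_on (facets K) K"
| "has_property (Facet Very_Weakly) K = very_weakly_chordal_on (facets K) K"
| "has_property (Facet Clique) K = clique_chordal_on (facets K) K"
| "has_property (Skeleton EC) K = E_chordal_on K K"
| "has_property (Skeleton Mid) K = mid_chordal_on {F \<in> K. card F \<ge> 2} K"
| "has_property (Skeleton Weakly) K = weakly_chordal_on K K"
| "has_property (Skeleton Very_Weakly) K = very_weakly_chordal_on K K"
| "has_property (Skeleton Clique) K = clique_chordal_on {F \<in> K. card F \<ge> 2} K"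

definition listed_implications :: "(chordal_property \<times> chordal_property) set" where
  "listed_implications =
     {(Skeleton EC, Skeleton Mid), (Skeleton Mid, Skeleton Weakly),
      (Skeleton Weakly, Skeleton Very_Weakly), (Skeleton Very_Weakly, Skeleton Clique)}
     \<union> {(Facet EC, Facet Mid), (Facet Mid, Facet Weakly), (Facet Weakly, Facet Very_Weakly)}
     \<union> {(Facet Mid, Facet Clique)}
     \<union> {(Skeleton X, Facet X) | X. True}"

end

theory Submission
  imports Defs
begin

text \<open>In a labeled complex, two faces have the same maximum iff they share a vertex \<open>v\<close> carrying
  the largest label of both, so each property becomes a condition on triples \<open>(F, G, v)\<close> and the
  implications hold with the same labeling. For the separations it suffices, by transitivity, to
  refute six implications, and complexes of dimension at most 2 do so, because a disjoint
  \<open>d\<close>-simplex raises the dimension harmlessly. A property fails under every labeling as soon as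
  there is a nonempty vertex set \<open>V\<close> such that each \<open>v \<in> V\<close> is a common vertex of two offending
  faces inside \<open>V\<close>: the vertex of \<open>V\<close> with the largest label is then their common maximum.\<close>

section \<open>Conditions on two faces at their common top vertex\<close>

fun local_cond :: "chordality \<Rightarrow> 'a set set \<Rightarrow> 'a set \<Rightarrow> 'a set \<Rightarrow> 'a \<Rightarrow> bool" where
  "local_cond EC K F G v \<longleftrightarrow> (\<forall>H. H \<subseteq> F \<union> G \<and> card H = card F \<longrightarrow> H \<in> K)"
| "local_cond Mid K F G v \<longleftrightarrow>
     (\<forall>e. e \<subseteq> F \<union> G - {v} \<and> card e = 2 \<longrightarrow>
        e \<in> K \<and> (\<exists>H\<in>K. card H = card F \<and> e \<subseteq> H \<and> H \<subseteq> F \<union> G - {v}))"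
| "local_cond Weakly K F G v \<longleftrightarrow> (\<exists>H\<in>K. card H = card F \<and> H \<subseteq> F \<union> G - {v})"
| "local_cond Very_Weakly K F G v \<longleftrightarrow> (adjacent F G \<longrightarrow> F \<union> G - {v} \<in> K)"
| "local_cond Clique K F G v \<longleftrightarrow> (\<forall>e. e \<subseteq> F \<union> G \<and> card e = 2 \<longrightarrow> e \<in> K)"

text \<open>The size bound of the skeleton mid and clique cases is supplied by
  \<open>common_top_card\<close>, so all skeleton properties share one range.\<close>

fun range_faces :: "chordal_property \<Rightarrow> 'a set set \<Rightarrow> 'a set set" where
  "range_faces (Facet X) K = facets K"
| "range_faces (Skeleton X) K = K"

fun kind :: "chordal_property \<Rightarrow> chordality" where
  "kind (Facet X) = X"
| "kind (Skeleton X) = X"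

text \<open>Naming the vertex and using inequalities instead of \<open>Max\<close> keeps the
  relation meaningful for every function \<open>l\<close> and easy to evaluate on explicit
  sets.\<close>

definition common_top :: "('a \<Rightarrow> nat) \<Rightarrow> 'a set \<Rightarrow> 'a set \<Rightarrow> 'a \<Rightarrow> bool" where
  "common_top l F G v \<longleftrightarrow>
     F \<noteq> G \<and> card F = card G \<and> v \<in> F \<and> v \<in> G \<and> (\<forall>w\<in>F \<union> G. l w \<le> l v)"

lemma range_faces_subset: "range_faces P K \<subseteq> K"
  by (cases P) (auto simp: facets_def)

lemma max_label_eq:
  assumes "finite F" "v \<in> F" "\<forall>w\<in>F. l w \<le> l v"
  shows "max_label l F = l v"
  unfolding max_label_def using assms by (intro Max_eqI) auto

context
  fixes K :: "'a set set" and l :: "'a \<Rightarrow> nat"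
  assumes K: "abstract_complex K" and l: "labeling K l"
begin

lemma face_finite: "F \<in> K \<Longrightarrow> finite F"
  using K by (auto simp: abstract_complex_def)

lemma label_inj: "F \<in> K \<Longrightarrow> G \<in> K \<Longrightarrow> x \<in> F \<Longrightarrow> y \<in> G \<Longrightarrow> l x = l y \<longleftrightarrow> x = y"
  using l unfolding labeling_def bij_betw_def inj_on_def vertices_def by blast

text \<open>Labels are injective on vertices, so equal maxima are attained at one and the same
  vertex, which then lies in both faces.\<close>

lemma comparable_iff_common_top:
  assumes "F \<in> K" "G \<in> K"
  shows "comparable l F G \<longleftrightarrow> (\<exists>v. common_top l F G v)"
proof
  assume c: "comparable l F G"
  \<comment> \<open>Only the empty face has size 0, so two distinct faces of equal size are nonempty
    and their maxima are attained.\<close>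
  then have ne: "F \<noteq> {}" "G \<noteq> {}"
    using face_finite assms unfolding comparable_def by fastforce+
  obtain v where v: "v \<in> F" "l v = Max (l ` F)"
    using Max_in[of "l ` F"] ne face_finite[OF assms(1)]
    by (metis (no_types) finite_imageI image_iff image_is_empty)
  obtain w where w: "w \<in> G" "l w = Max (l ` G)"
    using Max_in[of "l ` G"] ne face_finite[OF assms(2)]
    by (metis (no_types) finite_imageI image_iff image_is_empty)
  have "l v = l w"
    using c v w by (simp add: comparable_def max_label_def)
  then have "v = w"
    using label_inj assms v w by blast
  moreover have "\<forall>u\<in>F. l u \<le> l v" "\<forall>u\<in>G. l u \<le> l w"
    using v w face_finite assms by simp_all
  ultimately show "\<exists>v. common_top l F G v"
    using c v w unfolding comparable_def common_top_def by blast
next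
  assume "\<exists>v. common_top l F G v"
  then obtain v where v: "common_top l F G v" ..
  have "max_label l F = l v" "max_label l G = l v"
    using v face_finite assms by (auto simp: common_top_def intro!: max_label_eq)
  then show "comparable l F G"
    using v by (simp add: comparable_def common_top_def)
qed

lemma union_minus_max_eq:
  assumes "F \<in> K" "G \<in> K" "common_top l F G v"
  shows "union_minus_max l F G = F \<union> G - {v}"
proof -
  have "max_label l F = l v"
    using assms face_finite by (auto simp: common_top_def intro!: max_label_eq)
  moreover have "l w = l v \<longleftrightarrow> w = v" if "w \<in> F \<union> G" for w
    using that assms label_inj[of _ F w v] unfolding common_top_def by blast
  ultimately show ?thesis
    by (auto simp: union_minus_max_def)
qed

text \<open>Two one-vertex faces through \<open>v\<close> would coincide.\<close>

lemma common_top_card: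
  assumes "F \<in> K" "G \<in> K" "common_top l F G v"
  shows "card F \<ge> 2"
proof (rule ccontr)
  assume "\<not> card F \<ge> 2"
  moreover have "card F > 0"
    using assms face_finite by (auto simp: common_top_def card_gt_0_iff)
  ultimately have "card F = 1" "card G = 1"
    using assms(3) by (simp_all add: common_top_def)
  then obtain x y where "F = {x}" "G = {y}"
    by (metis card_1_singletonE)
  then show False
    using assms(3) by (auto simp: common_top_def)
qed

end

text \<open>Brings all ten definitions into one shape, so that the range of faces and the kind of
  condition can be varied independently.\<close>

lemma has_property_iff:
  assumes K: "abstract_complex K"
  shows "has_property P K \<longleftrightarrow>
    (\<exists>l. labeling K l \<and>
       (\<forall>F\<in>range_faces P K. \<forall>G\<in>range_faces P K. \<forall>v. common_top l F G v \<longrightarrow>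
          local_cond (kind P) K F G v))"
proof -
  \<comment> \<open>\<open>R\<close> abstracts the conclusion about \<open>F \<union> G\<close>
    without its top; in the E and clique cases it ignores its argument.\<close>
  have eq: "(comparable l F G \<longrightarrow> R (union_minus_max l F G))
      \<longleftrightarrow> (\<forall>v. common_top l F G v \<longrightarrow> R (F \<union> G - {v}))"
    if "labeling K l" "F \<in> K" "G \<in> K" for l F G and R :: "'a set \<Rightarrow> bool"
    using comparable_iff_common_top[OF K that] union_minus_max_eq[OF K that] by metis
  have sub: "F \<in> K" if "F \<in> facets K" for F
    using that by (simp add: facets_def)
  have big: "(\<forall>F\<in>{F \<in> K. 2 \<le> card F}. \<forall>G\<in>{F \<in> K. 2 \<le> card F}. comparable l F G \<longrightarrow> R F G)
      \<longleftrightarrow> (\<forall>F\<in>K. \<forall>G\<in>K. comparable l F G \<longrightarrow> R F G)" if "labeling K l" for l R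
    using comparable_iff_common_top[OF K that] common_top_card[OF K that]
    by (smt (verit, best) comparable_def mem_Collect_eq)
  \<comment> \<open>\<open>conj_commute\<close> and \<open>imp_conjL\<close> move the adjacency
    premise behind \<open>comparable\<close>, where it becomes part of \<open>R\<close>.\<close>
  note unfolds = has_property.simps E_chordal_on_def mid_chordal_on_def weakly_chordal_on_def
    very_weakly_chordal_on_def clique_chordal_on_def big range_faces.simps kind.simps
    local_cond.simps conj_commute[of "adjacent _ _"] imp_conjL
  show ?thesis
  proof (cases P)
    case (Facet X)
    show ?thesis
      unfolding Facet
      by (cases X; simp only: unfolds cong: conj_cong; intro ex_cong1 conj_cong refl ball_cong;
          rule eq[OF _ sub sub])
  next
    case (Skeleton X)
    show ?thesis
      unfolding Skeleton
      by (cases X; simp only: unfolds cong: conj_cong; intro ex_cong1 conj_cong refl ball_cong;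
          rule eq)
  qed
qed

section \<open>The listed implications\<close>

lemma abstract_complexD:
  assumes "abstract_complex K"
  shows "finite K" "F \<in> K \<Longrightarrow> finite F" "F \<in> K \<Longrightarrow> G \<subseteq> F \<Longrightarrow> G \<in> K"
  using assms by (auto simp: abstract_complex_def)

text \<open>The union of two distinct sets of equal size is strictly larger than each, which makes
  up for the loss of \<open>v\<close>.\<close>

lemma card_union_common:
  assumes "finite F" "finite G" "card F = card G" "F \<noteq> G" "v \<in> F"
  shows "card F \<le> card (F \<union> G - {v})"
proof -
  have "F \<subset> F \<union> G"
    using assms by (metis Un_upper1 Un_upper2 card_subset_eq psubsetI)
  then have "card F < card (F \<union> G)"
    using assms by (intro psubset_card_mono) auto
  then show ?thesis
    using assms by simp
qed

text \<open>By \<open>card_union_common\<close> there is room to extend an edge avoiding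
  \<open>v\<close> to a set of size \<open>card F\<close> that still avoids \<open>v\<close>; the
  E-condition makes this set a face.\<close>

lemma local_cond_EC_Mid:
  assumes K: "abstract_complex K" and FG: "F \<in> K" "G \<in> K"
    and top: "card F = card G" "F \<noteq> G" "v \<in> F" "2 \<le> card F"
    and EC: "local_cond EC K F G v"
  shows "local_cond Mid K F G v"
  unfolding local_cond.simps
proof (intro allI impI)
  fix e assume e: "e \<subseteq> F \<union> G - {v} \<and> card e = 2"
  have fin: "finite F" "finite G"
    using K FG by (auto dest: abstract_complexD)
  obtain H where H: "e \<subseteq> H" "H \<subseteq> F \<union> G - {v}" "card H = card F"
    using exists_subset_between[of e "card F" "F \<union> G - {v}"] e fin top
      card_union_common[OF fin top(1-3)] by auto
  then have "H \<in> K"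
    using EC by auto
  with H show "e \<in> K \<and> (\<exists>H\<in>K. card H = card F \<and> e \<subseteq> H \<and> H \<subseteq> F \<union> G - {v})"
    using abstract_complexD(3)[OF K] by blast
qed

text \<open>The set \<open>F \<union> G - {v}\<close> has at least two elements, hence contains an
  edge, and the face provided for that edge serves.\<close>

lemma local_cond_Mid_Weakly:
  assumes K: "abstract_complex K" and FG: "F \<in> K" "G \<in> K"
    and top: "card F = card G" "F \<noteq> G" "v \<in> F" "2 \<le> card F"
    and Mid: "local_cond Mid K F G v"
  shows "local_cond Weakly K F G v"
proof -
  have fin: "finite F" "finite G"
    using K FG by (auto dest: abstract_complexD)
  obtain e where "e \<subseteq> F \<union> G - {v}" "card e = 2"
    using obtain_subset_with_card_n[of 2 "F \<union> G - {v}"] card_union_common[OF fin top(1-3)] top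
    by (metis le_trans)
  then show ?thesis
    using Mid unfolding local_cond.simps by blast
qed

text \<open>A pair containing \<open>v\<close> lies in \<open>F\<close> or in \<open>G\<close>,
  since \<open>v\<close> belongs to both; all other pairs are covered by the mid condition.\<close>

lemma local_cond_Mid_Clique:
  assumes K: "abstract_complex K" and FG: "F \<in> K" "G \<in> K"
    and top: "v \<in> F" "v \<in> G"
    and Mid: "local_cond Mid K F G v"
  shows "local_cond Clique K F G v"
  unfolding local_cond.simps
proof (intro allI impI)
  fix e assume e: "e \<subseteq> F \<union> G \<and> card e = 2"
  show "e \<in> K"
  proof (cases "v \<in> e")
    case True
    then obtain x where "e = {v, x}"
      using e by (metis card_2_iff insert_commute insertE singletonD)
    then have "e \<subseteq> F \<or> e \<subseteq> G"
      using e top by auto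
    then show ?thesis
      using abstract_complexD(3)[OF K] FG by blast
  next
    case False
    then have "e \<subseteq> F \<union> G - {v} \<and> card e = 2"
      using e by blast
    then show ?thesis
      using Mid unfolding local_cond.simps by blast
  qed
qed

text \<open>For adjacent faces \<open>F \<union> G - {v}\<close> has exactly \<open>card F\<close>
  elements, so the face found inside it is the whole set.\<close>

lemma local_cond_Weakly_Very_Weakly:
  assumes K: "abstract_complex K" and FG: "F \<in> K" "G \<in> K"
    and top: "v \<in> F"
    and Weakly: "local_cond Weakly K F G v"
  shows "local_cond Very_Weakly K F G v"
  unfolding local_cond.simps
proof
  assume adj: "adjacent F G"
  have fin: "finite F" "finite G"
    using K FG by (auto dest: abstract_complexD)
  have c: "card F = card G" "card (F \<inter> G) + 1 = card F"
    using adj by (auto simp: adjacent_def face_dim_def)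
  then have "card (F \<union> G) = card F + 1"
    using card_Un_Int[OF fin] by linarith
  then have "card (F \<union> G - {v}) = card F"
    using top fin by simp
  moreover obtain H where "H \<in> K" "card H = card F" "H \<subseteq> F \<union> G - {v}"
    using Weakly by auto
  ultimately show "F \<union> G - {v} \<in> K"
    using fin by (metis card_subset_eq finite_Diff finite_UnI)
qed

text \<open>For \<open>x\<close> in \<open>F\<close> only and \<open>y\<close> in \<open>G\<close>
  only, the edges \<open>{x, v}\<close> and \<open>{y, v}\<close> are adjacent with top
  \<open>v\<close>, and the very weak condition yields \<open>{x, y}\<close>. This applies the
  hypothesis to smaller faces, so it is an argument about skeletons and not about facets.\<close>

lemma skeleton_very_weakly_imp_clique:
  assumes K: "abstract_complex K" and FG: "F \<in> K" "G \<in> K"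
    and top: "common_top l F G v"
    and VW: "\<And>f g. f \<in> K \<Longrightarrow> g \<in> K \<Longrightarrow> common_top l f g v \<Longrightarrow> local_cond Very_Weakly K f g v"
  shows "local_cond Clique K F G v"
  unfolding local_cond.simps
proof (intro allI impI)
  fix e assume e: "e \<subseteq> F \<union> G \<and> card e = 2"
  have down: "S \<in> K" if "S \<subseteq> F \<or> S \<subseteq> G" for S
    using that abstract_complexD(3)[OF K] FG by blast
  show "e \<in> K"
  proof (cases "e \<subseteq> F \<or> e \<subseteq> G")
    case False
    then obtain x y where xy: "e = {x, y}" "x \<in> F" "x \<notin> G" "y \<in> G" "y \<notin> F"
      using e by (auto simp: card_2_iff)
    have v: "v \<in> F" "v \<in> G" "\<forall>w\<in>F \<union> G. l w \<le> l v"
      using top by (auto simp: common_top_def)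
    have ne: "x \<noteq> v" "y \<noteq> v" "x \<noteq> y"
      using xy v by auto
    have "{x, v} \<inter> {y, v} = {v}"
      using ne by auto
    then have "adjacent {x, v} {y, v}"
      using ne by (simp add: adjacent_def face_dim_def)
    moreover have "common_top l {x, v} {y, v} v"
      using ne xy v by (auto simp: common_top_def doubleton_eq_iff)
    ultimately have "{x, v} \<union> {y, v} - {v} \<in> K"
      using VW[of "{x, v}" "{y, v}"] down xy v by simp
    also have "{x, v} \<union> {y, v} - {v} = e"
      using ne xy by auto
    finally show ?thesis .
  qed (use down in blast)
qed

text \<open>The labeling that witnesses \<open>P\<close> also witnesses \<open>Q\<close>.\<close>

lemma has_property_transfer:
  assumes K: "abstract_complex K" and P: "has_property P K"
    and sub: "range_faces Q K \<subseteq> range_faces P K"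
    and imp: "\<And>l F G v. F \<in> K \<Longrightarrow> G \<in> K \<Longrightarrow> common_top l F G v \<Longrightarrow> 2 \<le> card F \<Longrightarrow>
      local_cond (kind P) K F G v \<Longrightarrow> local_cond (kind Q) K F G v"
  shows "has_property Q K"
proof -
  obtain l where l: "labeling K l"
    and h: "\<And>F G v. F \<in> range_faces P K \<Longrightarrow> G \<in> range_faces P K \<Longrightarrow> common_top l F G v
      \<Longrightarrow> local_cond (kind P) K F G v"
    using P has_property_iff[OF K] by blast
  have "local_cond (kind Q) K F G v"
    if "F \<in> range_faces Q K" "G \<in> range_faces Q K" "common_top l F G v" for F G v
  proof -
    have FG: "F \<in> K" "G \<in> K"
      using that range_faces_subset by blast+
    have "local_cond (kind P) K F G v"
      using that sub by (intro h) auto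
    then show ?thesis
      using imp[OF FG that(3) common_top_card[OF K l FG that(3)]] by blast
  qed
  then show ?thesis
    using l has_property_iff[OF K] by blast
qed

lemma listed_implication_holds:
  assumes K: "abstract_complex K" and P: "has_property P K" and PQ: "(P, Q) \<in> listed_implications"
  shows "has_property Q K"
proof -
  note transfer = has_property_transfer[OF K P]
  \<comment> \<open>Where the argument concerns a single triple \<open>F\<close>, \<open>G\<close>,
    \<open>v\<close>, the facet and the skeleton version are treated together; \<open>VC\<close>
    stands apart because it passes to edges, and \<open>SF\<close> only shrinks the range to
    facets.\<close>
  consider (EM) "kind P = EC" "kind Q = Mid" "range_faces P K = range_faces Q K"
    | (MW) "kind P = Mid" "kind Q = Weakly" "range_faces P K = range_faces Q K"
    | (MC) "kind P = Mid" "kind Q = Clique" "range_faces P K = range_faces Q K"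
    | (WV) "kind P = Weakly" "kind Q = Very_Weakly" "range_faces P K = range_faces Q K"
    | (VC) "P = Skeleton Very_Weakly" "Q = Skeleton Clique"
    | (SF) "kind P = kind Q" "range_faces Q K \<subseteq> range_faces P K"
    using PQ unfolding listed_implications_def by (auto simp: facets_def)
  then show ?thesis
  proof cases
    case VC
    obtain l where l: "labeling K l"
      and h: "\<forall>F\<in>K. \<forall>G\<in>K. \<forall>v. common_top l F G v \<longrightarrow> local_cond Very_Weakly K F G v"
      using P VC has_property_iff[OF K, of P] by (auto simp del: local_cond.simps)
    have "local_cond Clique K F G v" if "F \<in> K" "G \<in> K" "common_top l F G v" for F G v
      using skeleton_very_weakly_imp_clique[OF K that] h by blast
    then show ?thesis
      using l VC has_property_iff[OF K, of Q] by (auto simp del: local_cond.simps)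
  next
    case EM
    then show ?thesis
      by (intro transfer)
        (auto simp: common_top_def simp del: local_cond.simps intro: local_cond_EC_Mid[OF K])
  next
    case MW
    then show ?thesis
      by (intro transfer)
        (auto simp: common_top_def simp del: local_cond.simps intro: local_cond_Mid_Weakly[OF K])
  next
    case MC
    then show ?thesis
      by (intro transfer)
        (auto simp: common_top_def simp del: local_cond.simps intro: local_cond_Mid_Clique[OF K])
  next
    case WV
    then show ?thesis
      by (intro transfer)
        (auto simp: common_top_def simp del: local_cond.simps
          intro: local_cond_Weakly_Very_Weakly[OF K])
  next
    case SF
    then show ?thesis
      by (intro transfer) auto
  qed
qed

section \<open>Complexes generated by a finite list of faces\<close>

definition spanned :: "'a set set \<Rightarrow> 'a set set" where
  "spanned T = {F. \<exists>t\<in>T. F \<subseteq> t}"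

lemma spanned_iff: "F \<in> spanned T \<longleftrightarrow> (\<exists>t\<in>T. F \<subseteq> t)"
  by (simp add: spanned_def)

lemma abstract_complex_spanned:
  assumes "finite T" "\<And>t. t \<in> T \<Longrightarrow> finite t" "T \<noteq> {}"
  shows "abstract_complex (spanned T)"
proof -
  have "spanned T = (\<Union>t\<in>T. Pow t)"
    by (auto simp: spanned_def)
  then have "finite (spanned T)"
    using assms by auto
  moreover have "\<forall>F\<in>spanned T. finite F"
  proof
    fix F assume "F \<in> spanned T"
    then obtain t where "t \<in> T" "F \<subseteq> t"
      by (auto simp: spanned_iff)
    then show "finite F"
      using assms(2) finite_subset by blast
  qed
  moreover have "{} \<in> spanned T"
    using assms(3) by (auto simp: spanned_iff)
  moreover have "\<forall>F\<in>spanned T. \<forall>G. G \<subseteq> F \<longrightarrow> G \<in> spanned T"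
    unfolding spanned_def by blast
  ultimately show ?thesis
    by (simp add: abstract_complex_def)
qed

lemma vertices_spanned: "vertices (spanned T) = \<Union>T"
  by (auto simp: vertices_def spanned_def)

lemma facets_spanned_subset: "facets (spanned T) \<subseteq> T"
  by (auto simp: facets_def spanned_def)

text \<open>A face of the largest possible size fills the generator containing it. Deciding which
  triangles are faces thus reduces to inspecting \<open>T\<close>.\<close>

lemma face_in_generators:
  assumes "F \<in> spanned T" "card F = k" "\<And>t. t \<in> T \<Longrightarrow> finite t \<and> card t \<le> k"
  shows "F \<in> T"
proof -
  obtain t where "t \<in> T" "F \<subseteq> t"
    using assms(1) by (auto simp: spanned_iff)
  moreover have "F = t"
    using calculation assms(2,3) card_seteq[of t F] by simp
  ultimately show ?thesis by simp
qed

lemma generator_is_facet: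
  assumes "F \<in> T" "card F = k" "\<And>t. t \<in> T \<Longrightarrow> finite t \<and> card t \<le> k"
  shows "F \<in> facets (spanned T)"
proof -
  have "G = F" if G: "G \<in> spanned T" "F \<subseteq> G" for G
  proof -
    obtain t where t: "t \<in> T" "G \<subseteq> t"
      using G(1) by (auto simp: spanned_iff)
    then have "F = t"
      using G(2) assms card_seteq[of t F] by auto
    then show ?thesis
      using G t by blast
  qed
  then show ?thesis
    using assms(1) by (auto simp: facets_def spanned_iff)
qed

section \<open>Raising the dimension by a disjoint simplex\<close>

text \<open>Every set whose membership in \<open>K\<close> a condition demands lies inside
  \<open>F \<union> G\<close>. This carries conditions both from a small complex to its enlargement
  and back.\<close>

lemma local_cond_subset:
  assumes "local_cond X K F G v" "\<And>H. H \<in> K \<Longrightarrow> H \<subseteq> F \<union> G \<Longrightarrow> H \<in> K'"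
  shows "local_cond X K' F G v"
proof (cases X)
  case Mid
  have "H \<in> K'" if "H \<in> K" "H \<subseteq> F \<union> G - {v}" for H
    using assms(2) that by blast
  then show ?thesis
    using assms(1) unfolding Mid local_cond.simps by meson
next
  case Weakly
  have "H \<in> K'" if "H \<in> K" "H \<subseteq> F \<union> G - {v}" for H
    using assms(2) that by blast
  then show ?thesis
    using assms(1) unfolding Weakly local_cond.simps by meson
next
  case Very_Weakly
  then show ?thesis
    using assms(1) assms(2)[of "F \<union> G - {v}"] by auto
qed (use assms in auto)

text \<open>The E-condition is the strongest of the five, so all of them hold where every subset of
  \<open>F \<union> G\<close> of the right size is a face.\<close>

lemma local_cond_if_EC:
  assumes K: "abstract_complex K" and FG: "F \<in> K" "G \<in> K"
    and top: "common_top l F G v" "2 \<le> card F"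
    and EC: "local_cond EC K F G v"
  shows "local_cond X K F G v"
proof -
  have t: "card F = card G" "F \<noteq> G" "v \<in> F" "v \<in> G"
    using top by (auto simp: common_top_def)
  have Mid: "local_cond Mid K F G v"
    by (rule local_cond_EC_Mid[OF K FG t(1-3) top(2) EC])
  have Weakly: "local_cond Weakly K F G v"
    by (rule local_cond_Mid_Weakly[OF K FG t(1-3) top(2) Mid])
  show ?thesis
    using EC Mid Weakly local_cond_Weakly_Very_Weakly[OF K FG t(3) Weakly]
      local_cond_Mid_Clique[OF K FG t(3,4) Mid]
    by (cases X) simp_all
qed

lemma finite_arg_max_nat:
  fixes l :: "'a \<Rightarrow> nat"
  assumes "finite V" "V \<noteq> {}"
  shows "\<exists>v\<in>V. \<forall>w\<in>V. l w \<le> l v"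
proof -
  have "Max (l ` V) \<in> l ` V"
    using assms by (intro Max_in) auto
  then obtain v where "v \<in> V" "l v = Max (l ` V)"
    by (metis imageE)
  then show ?thesis
    using assms by (metis Max_ge finite_imageI imageI)
qed

definition separated :: "nat \<Rightarrow> chordal_property \<Rightarrow> chordal_property \<Rightarrow> bool" where
  "separated d P Q \<longleftrightarrow> (\<exists>K :: nat set set. abstract_complex K \<and> complex_dim K = int d
     \<and> has_property P K \<and> \<not> has_property Q K)"

text \<open>Adding a disjoint simplex \<open>\<sigma>\<close> on \<open>d + 1\<close> new vertices
  makes the dimension exactly \<open>d\<close>, as the generators in \<open>T\<close> have at most
  three vertices. \<open>P\<close> is checked for the single labeling \<open>Suc\<close>, whereas
  \<open>Q\<close> has to fail for every labeling, which \<open>V\<close> guarantees.\<close>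

lemma separatedI:
  fixes T :: "nat set set"
  assumes T: "finite T" "\<Union>T = {..<n}" "\<And>t. t \<in> T \<Longrightarrow> card t \<le> 3" and d: "2 \<le> d"
    and pos: "\<And>F G v. F \<in> range_faces P (spanned T) \<Longrightarrow> G \<in> range_faces P (spanned T) \<Longrightarrow>
      common_top Suc F G v \<Longrightarrow> local_cond (kind P) (spanned T) F G v"
    and V: "V \<noteq> {}" "V \<subseteq> {..<n}"
    and neg: "\<And>v. v \<in> V \<Longrightarrow>
      \<exists>F\<in>range_faces Q (spanned T). \<exists>G\<in>range_faces Q (spanned T).
        F \<union> G \<subseteq> V \<and> v \<in> F \<and> v \<in> G \<and> F \<noteq> G \<and> card F = card G \<and>
        \<not> local_cond (kind Q) (spanned T) F G v"
  shows "separated d P Q"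
proof -
  define \<sigma> where "\<sigma> = {n..n + d}"
  define K where "K = spanned T"
  define L where "L = spanned (insert \<sigma> T)"
  have L_iff: "F \<in> L \<longleftrightarrow> F \<in> K \<or> F \<subseteq> \<sigma>" for F
    by (auto simp: K_def L_def spanned_iff)
  have T_sub: "t \<subseteq> {..<n}" if "t \<in> T" for t
    using that T(2) by auto
  have T_fin: "finite t" if "t \<in> T" for t
    using T_sub[OF that] finite_subset by blast
  have K_sub: "F \<subseteq> {..<n}" if "F \<in> K" for F
    using that T_sub by (auto simp: K_def spanned_iff)
  have T_ne: "T \<noteq> {}"
    using T(2) V by auto
  have L: "abstract_complex L"
    unfolding L_def using T T_fin by (intro abstract_complex_spanned) (auto simp: \<sigma>_def)
  have empty_K: "{} \<in> K"
    using T_ne by (auto simp: K_def spanned_iff)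
  have disj: "F = {}" if "F \<subseteq> {..<n}" "F \<subseteq> \<sigma>" for F
    using that by (fastforce simp: \<sigma>_def)
  have low: "F \<in> K" if "F \<in> L" "F \<subseteq> {..<n}" for F
    using that L_iff disj empty_K by metis
  have range_low: "F \<in> range_faces R K" if "F \<in> range_faces R L" "F \<subseteq> {..<n}" for R F
    using that low L_iff by (cases R) (auto simp: facets_def)
  \<comment> \<open>A nonempty face of \<open>K\<close> is not contained in \<open>\<sigma>\<close>,
    so facets of \<open>K\<close> stay facets of \<open>L\<close>.\<close>
  have range_up: "F \<in> range_faces R L" if "F \<in> range_faces R K" "F \<noteq> {}" for R F
  proof (cases R)
    case (Facet X)
    have F: "F \<in> K" "\<And>G. G \<in> K \<Longrightarrow> F \<subseteq> G \<Longrightarrow> G = F"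
      using that Facet by (auto simp: facets_def)
    have "\<not> F \<subseteq> \<sigma>"
      using disj K_sub F(1) that(2) by blast
    then have "G = F" if "G \<in> L" "F \<subseteq> G" for G
      using that L_iff F(2) by blast
    then show ?thesis
      using F(1) L_iff Facet by (auto simp: facets_def)
  qed (use that L_iff in auto)

  have card_L: "card F \<le> Suc d" if F: "F \<in> L" for F
  proof (cases "F \<subseteq> \<sigma>")
    case True
    then show ?thesis
      using card_mono[of \<sigma> F] by (simp add: \<sigma>_def)
  next
    case False
    then obtain t where "t \<in> T" "F \<subseteq> t"
      using F by (auto simp: L_def spanned_iff)
    then show ?thesis
      using card_mono[OF T_fin, of t F] T(3)[of t] d by linarith
  qed
  have dim: "complex_dim L = int d"
    unfolding complex_dim_def
  proof (rule Max_eqI)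
    show "finite (face_dim ` L)"
      using abstract_complexD(1)[OF L] by simp
    show "y \<le> int d" if "y \<in> face_dim ` L" for y
      using that card_L by (fastforce simp: face_dim_def)
    have "face_dim \<sigma> = int d"
      by (simp add: face_dim_def \<sigma>_def)
    then show "int d \<in> face_dim ` L"
      using L_iff[of \<sigma>] by (auto intro: rev_image_eqI)
  qed

  have vert: "vertices L = {..<Suc (n + d)}"
    unfolding L_def vertices_spanned using T(2) by (auto simp: \<sigma>_def)
  \<comment> \<open>Vertices are counted from 0 and labels from 1, hence \<open>Suc\<close>.\<close>
  have lab: "labeling L Suc"
    unfolding labeling_def vert
    by (auto simp: bij_betw_def image_Suc_lessThan)
  \<comment> \<open>The vertices of \<open>\<sigma>\<close> carry the largest labels. A top
    \<open>v < n\<close> therefore forces both faces into \<open>K\<close>, and any other top forces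
    both into \<open>\<sigma>\<close>.\<close>
  have "local_cond (kind P) L F G v"
    if FG: "F \<in> range_faces P L" "G \<in> range_faces P L" and top: "common_top Suc F G v" for F G v
  proof (cases "v < n")
    case True
    have "w < n" if "w \<in> F \<union> G" for w
    proof -
      have "Suc w \<le> Suc v"
        using top that unfolding common_top_def by blast
      then show ?thesis
        using True by simp
    qed
    then have sub: "F \<subseteq> {..<n}" "G \<subseteq> {..<n}"
      by auto
    have "local_cond (kind P) K F G v"
      unfolding K_def using FG sub top by (intro pos) (auto intro: range_low simp flip: K_def)
    then show ?thesis
      by (rule local_cond_subset) (simp add: L_iff)
  next
    case False
    have FGL: "F \<in> L" "G \<in> L"
      using FG range_faces_subset by blast+
    have v: "v \<in> F" "v \<in> G" "F \<noteq> G"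
      using top by (auto simp: common_top_def)
    have "\<not> F \<subseteq> {..<n}" "\<not> G \<subseteq> {..<n}"
      using v False by auto
    then have sub: "F \<subseteq> \<sigma>" "G \<subseteq> \<sigma>"
      using FGL K_sub L_iff by metis+
    \<comment> \<open>The only facet inside \<open>\<sigma>\<close> is \<open>\<sigma>\<close>
      itself, so distinct facets are excluded; for skeletons, all subsets of a simplex are
      faces.\<close>
    show ?thesis
    proof (cases P)
      case (Facet X)
      then have "F = \<sigma>" "G = \<sigma>"
        using FG sub L_iff by (auto simp: facets_def)
      then show ?thesis
        using v by simp
    next
      case (Skeleton X)
      have "local_cond EC L F G v"
        using sub by (auto simp: L_iff)
      then show ?thesis
        using local_cond_if_EC[OF L FGL top common_top_card[OF L lab FGL top]] by blast
    qed
  qed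
  then have "has_property P L"
    using lab has_property_iff[OF L] by blast

  moreover have "\<not> has_property Q L"
  proof
    assume "has_property Q L"
    then obtain l where l: "\<And>F G v. F \<in> range_faces Q L \<Longrightarrow> G \<in> range_faces Q L \<Longrightarrow>
        common_top l F G v \<Longrightarrow> local_cond (kind Q) L F G v"
      using has_property_iff[OF L] by blast
    obtain v where v: "v \<in> V" "\<forall>w\<in>V. l w \<le> l v"
      using finite_arg_max_nat[of V l] V finite_subset by blast
    obtain F G where FG: "F \<in> range_faces Q K" "G \<in> range_faces Q K"
      and top: "F \<union> G \<subseteq> V" "v \<in> F" "v \<in> G" "F \<noteq> G" "card F = card G"
      and not: "\<not> local_cond (kind Q) K F G v"
      using neg[OF v(1)] unfolding K_def by blast
    have "common_top l F G v"
      using v top unfolding common_top_def by blast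
    then have "local_cond (kind Q) L F G v"
      using FG top by (intro l range_up) auto
    moreover have "F \<union> G \<subseteq> {..<n}"
      using top V by blast
    ultimately have "local_cond (kind Q) K F G v"
      using low by (elim local_cond_subset) (meson order_trans)
    with not show False ..
  qed
  ultimately show ?thesis
    unfolding separated_def using L dim by (intro exI[of _ L] conjI)
qed

section \<open>Tests for two-dimensional complexes\<close>

text \<open>If all pairs of vertices are edges, two edges satisfy even the E-condition, so only
  pairs of triangles remain to be checked.\<close>

lemma local_cond_complete_graph:
  fixes T :: "nat set set"
  assumes T: "finite T" "\<And>t. t \<in> T \<Longrightarrow> finite t \<and> card t \<le> 3"
    and pairs: "\<And>x y. x \<in> \<Union>T \<Longrightarrow> y \<in> \<Union>T \<Longrightarrow> {x, y} \<in> spanned T"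
    and triangles: "\<And>F G v. F \<in> T \<Longrightarrow> G \<in> T \<Longrightarrow> card F = 3 \<Longrightarrow> common_top Suc F G v \<Longrightarrow>
      local_cond X (spanned T) F G v"
    and FG: "F \<in> spanned T" "G \<in> spanned T" and top: "common_top Suc F G v"
  shows "local_cond X (spanned T) F G v"
proof -
  have K: "abstract_complex (spanned T)"
    using T FG by (intro abstract_complex_spanned) (auto simp: spanned_iff)
  have fin: "finite F" "finite G" and sub: "F \<subseteq> \<Union>T" "G \<subseteq> \<Union>T"
    using FG abstract_complexD(2)[OF K] by (auto simp: spanned_iff)
  have t: "card F = card G" "F \<noteq> G" "v \<in> F" "v \<in> G"
    using top by (auto simp: common_top_def)
  have "card F \<noteq> 0"
    using fin t by auto
  moreover have "card F \<noteq> 1"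
    using t by (metis card_1_singletonE singletonD)
  moreover have "card F \<le> 3"
    using FG(1) T(2) by (meson card_mono order_trans spanned_iff)
  ultimately consider "card F = 2" | "card F = 3"
    by linarith
  then show ?thesis
  proof cases
    case 1
    have "local_cond EC (spanned T) F G v"
      unfolding local_cond.simps
    proof (intro allI impI)
      fix H assume H: "H \<subseteq> F \<union> G \<and> card H = card F"
      then obtain x y where "H = {x, y}"
        using 1 by (auto simp: card_2_iff)
      then show "H \<in> spanned T"
        using H sub by (auto intro: pairs)
    qed
    then show ?thesis
      using local_cond_if_EC[OF K FG top] 1 by simp
  next
    case 2
    then have "F \<in> T" "G \<in> T"
      using face_in_generators[OF FG(1) _ T(2)] face_in_generators[OF FG(2) _ T(2)] t(1) by simp_all
    then show ?thesis
      using 2 top by (rule triangles)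
  qed
qed

lemma not_local_Weakly:
  assumes T: "\<And>t. t \<in> T \<Longrightarrow> finite t \<and> card t \<le> 3"
    and F: "card F = 3" and no: "\<forall>H\<in>T. card H = 3 \<longrightarrow> \<not> H \<subseteq> F \<union> G - {v}"
  shows "\<not> local_cond Weakly (spanned T) F G v"
  using F no face_in_generators[OF _ _ T] unfolding local_cond.simps by metis

lemma not_local_Mid:
  assumes T: "\<And>t. t \<in> T \<Longrightarrow> finite t \<and> card t \<le> 3"
    and F: "card F = 3" and xy: "x \<in> F" "y \<in> G" "x \<noteq> y" "x \<noteq> v" "y \<noteq> v"
    and no: "\<forall>H\<in>T. card H = 3 \<and> x \<in> H \<and> y \<in> H \<longrightarrow> \<not> H \<subseteq> F \<union> G - {v}"
  shows "\<not> local_cond Mid (spanned T) F G v"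
proof
  assume "local_cond Mid (spanned T) F G v"
  moreover have "{x, y} \<subseteq> F \<union> G - {v} \<and> card {x, y} = 2"
    using xy by auto
  ultimately obtain H where H: "H \<in> spanned T" "card H = 3" "{x, y} \<subseteq> H" "H \<subseteq> F \<union> G - {v}"
    unfolding local_cond.simps F by meson
  then show False
    using no face_in_generators[OF H(1,2) T] by auto
qed

lemma not_local_Clique:
  assumes "x \<in> F" "y \<in> G" "x \<noteq> y" "{x, y} \<notin> K"
  shows "\<not> local_cond Clique K F G v"
proof
  assume "local_cond Clique K F G v"
  moreover have "{x, y} \<subseteq> F \<union> G \<and> card {x, y} = 2"
    using assms by auto
  ultimately show False
    using assms(4) unfolding local_cond.simps by blast
qed

text \<open>Equal sizes turn \<open>F \<noteq> G\<close> into \<open>\<not> F \<subseteq> G\<close>.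
  In this form, with bounded quantifiers only, \<open>simp\<close> can evaluate the relation on
  explicit sets.\<close>

lemma common_topD:
  assumes "common_top Suc F G v" "finite G"
  shows "v \<in> F" "v \<in> G \<and> (\<forall>w\<in>F \<union> G. w \<le> v) \<and> \<not> F \<subseteq> G"
  using assms card_subset_eq[of G F] by (auto simp: common_top_def)

section \<open>The six separating complexes\<close>

lemma Facet_EC_not_Skeleton_Clique:
  assumes "2 \<le> d"
  shows "separated d (Facet EC) (Skeleton Clique)"
proof -
  \<comment> \<open>A 4-cycle with a triangle glued to each edge.\<close>
  define T :: "nat set set" where "T = {{0,1,4}, {1,2,5}, {2,3,6}, {0,3,7}}"
  have T: "t \<in> T \<Longrightarrow> finite t \<and> card t \<le> 3" for t
    by (auto simp: T_def)
  show ?thesis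
  proof (rule separatedI[of T 8 _ _ "{0,1,2,3}"])
    show "finite T" "\<Union>T = {..<8}"
      by (auto simp: T_def)
    fix F G v
    assume "F \<in> range_faces (Facet EC) (spanned T)" "G \<in> range_faces (Facet EC) (spanned T)"
      and top: "common_top Suc F G v"
    then have "F \<in> T" "G \<in> T"
      using facets_spanned_subset by auto
    \<comment> \<open>The four triangles have the distinct tops 4, 5, 6, 7, so the facet condition
      is vacuous.\<close>
    moreover have "\<forall>F\<in>T. \<forall>G\<in>T. \<forall>v\<in>F. \<not> (v \<in> G \<and> (\<forall>w\<in>F \<union> G. w \<le> v) \<and> \<not> F \<subseteq> G)"
      by (simp add: T_def)
    ultimately show "local_cond (kind (Facet EC)) (spanned T) F G v"
      using common_topD[OF top] T by blast
  next
    fix v :: nat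
    assume "v \<in> {0,1,2,3}"
    \<comment> \<open>The two neighbours of \<open>v\<close> on the 4-cycle are not joined by an
      edge.\<close>
    moreover have "\<forall>v\<in>{0,1,2,3}. \<exists>x\<in>{0,1,2,3}. \<exists>y\<in>{0,1,2,3}. x \<noteq> v \<and> y \<noteq> v \<and> x \<noteq> y \<and>
        {x, v} \<in> spanned T \<and> {y, v} \<in> spanned T \<and> {x, y} \<notin> spanned T"
      by (simp add: T_def spanned_iff)
    ultimately obtain x y where xy: "x \<in> {0,1,2,3}" "y \<in> {0,1,2,3}" "x \<noteq> v" "y \<noteq> v" "x \<noteq> y"
        "{x, v} \<in> spanned T" "{y, v} \<in> spanned T" "{x, y} \<notin> spanned T"
      by meson
    show "\<exists>F\<in>range_faces (Skeleton Clique) (spanned T).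
        \<exists>G\<in>range_faces (Skeleton Clique) (spanned T). F \<union> G \<subseteq> {0,1,2,3} \<and> v \<in> F \<and> v \<in> G \<and>
          F \<noteq> G \<and> card F = card G \<and> \<not> local_cond (kind (Skeleton Clique)) (spanned T) F G v"
      using xy \<open>v \<in> {0,1,2,3}\<close> not_local_Clique[of x "{x, v}" y "{y, v}" "spanned T" v]
      by (intro bexI[of _ "{x, v}"] bexI[of _ "{y, v}"])
        (auto simp: doubleton_eq_iff simp del: local_cond.simps)
  qed (use T assms in auto)
qed

text \<open>\<open>V\<close> is taken to be the whole vertex set of \<open>T\<close>. The table
  \<open>W\<close> offers for each vertex \<open>v\<close> two triangles through it, and
  \<open>R\<close> is an obstruction that \<open>simp\<close> can check on this table.\<close>

lemma separated_trianglesI: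
  fixes T :: "nat set set"
  assumes T: "finite T" "\<Union>T = {..<n}" "\<forall>t\<in>T. finite t \<and> card t \<le> 3"
    and d: "2 \<le> d" and n: "n > 0"
    and pos: "\<And>F G v. F \<in> range_faces P (spanned T) \<Longrightarrow> G \<in> range_faces P (spanned T) \<Longrightarrow>
      common_top Suc F G v \<Longrightarrow> local_cond (kind P) (spanned T) F G v"
    and W: "\<Union>T \<subseteq> fst ` W"
    and neg: "\<forall>(v, F, G)\<in>W. F \<in> T \<and> G \<in> T \<and> v \<in> F \<and> v \<in> G \<and> \<not> F \<subseteq> G \<and>
      card F = 3 \<and> card G = 3 \<and> R F G v"
    and R: "\<And>F G v. card F = 3 \<Longrightarrow> card G = 3 \<Longrightarrow> R F G v \<Longrightarrow>
      \<not> local_cond X (spanned T) F G v"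
  shows "separated d P (Facet X)"
proof (rule separatedI[OF T(1,2) _ d pos, of "\<Union>T"])
  show "\<Union>T \<noteq> {}" "\<Union>T \<subseteq> {..<n}"
    using T(2) n by auto
  fix v assume "v \<in> \<Union>T"
  then have "v \<in> fst ` W"
    by (rule subsetD[OF W])
  then obtain F G where "(v, F, G) \<in> W"
    by auto
  from bspec[OF neg this] have FG: "F \<in> T" "G \<in> T" "v \<in> F" "v \<in> G" "\<not> F \<subseteq> G"
    "card F = 3" "card G = 3" "R F G v"
    by simp_all
  have "F \<in> facets (spanned T)" "G \<in> facets (spanned T)"
    using FG T by (auto intro: generator_is_facet[where k = 3])
  then show "\<exists>F\<in>range_faces (Facet X) (spanned T). \<exists>G\<in>range_faces (Facet X) (spanned T).
      F \<union> G \<subseteq> \<Union>T \<and> v \<in> F \<and> v \<in> G \<and> F \<noteq> G \<and> card F = card G \<and>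
      \<not> local_cond (kind (Facet X)) (spanned T) F G v"
    using FG R[OF FG(6,7,8)]
    by (intro bexI[of _ F] bexI[of _ G]) (auto simp del: local_cond.simps)
qed (use T in auto)

lemma Skeleton_Mid_not_Facet_EC:
  assumes "2 \<le> d"
  shows "separated d (Skeleton Mid) (Facet EC)"
proof -
  \<comment> \<open>The cone over the boundary of a triangle.\<close>
  define T :: "nat set set" where "T = {{0,1,2}, {0,1,3}, {0,2,3}}"
  define W :: "(nat \<times> nat set \<times> nat set) set" where
    "W = {(0, {0,1,2}, {0,1,3}), (1, {0,1,2}, {0,1,3}),
      (2, {0,1,2}, {0,2,3}), (3, {0,1,3}, {0,2,3})}"
  have T: "finite T" "\<Union>T = {..<4}" "\<forall>t\<in>T. finite t \<and> card t \<le> 3"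
    by (auto simp: T_def)
  \<comment> \<open>This is the base of the cone. Any two of the three triangles cover all four
    vertices, so their union contains this non-face.\<close>
  have missing: "{1,2,3} \<notin> spanned T"
    by (simp add: T_def spanned_iff)
  show ?thesis
  proof (rule separated_trianglesI[OF T assms, where W = W and R = "\<lambda>F G v. {1,2,3} \<subseteq> F \<union> G"])
    fix F G v
    assume FG: "F \<in> range_faces (Skeleton Mid) (spanned T)"
        "G \<in> range_faces (Skeleton Mid) (spanned T)"
      and top: "common_top Suc F G v"
    have "local_cond Mid (spanned T) F G v"
    proof (rule local_cond_complete_graph[OF T(1) _ _ _ _ _ top])
      show "{x, y} \<in> spanned T" if "x \<in> \<Union>T" "y \<in> \<Union>T" for x y
        using that by (auto simp: T_def spanned_iff)
      fix F G v
      assume F: "F \<in> T" "G \<in> T" "card F = 3" "common_top Suc F G v"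
      \<comment> \<open>The only triangles with a common top are \<open>{0,1,3}\<close> and
        \<open>{0,2,3}\<close>; dropping 3 leaves the face \<open>{0,1,2}\<close>.\<close>
      have "\<forall>F\<in>T. \<forall>G\<in>T. \<forall>v\<in>F. v \<in> G \<and> (\<forall>w\<in>F \<union> G. w \<le> v) \<and> \<not> F \<subseteq> G \<longrightarrow>
          {0,1,2} \<subseteq> F \<union> G \<and> F \<union> G \<subseteq> {0,1,2,v} \<and> v \<notin> {0,1,2}"
        by (simp add: T_def)
      then have "{0,1,2} \<subseteq> F \<union> G \<and> F \<union> G \<subseteq> {0,1,2,v} \<and> v \<notin> {0,1,2}"
        using F(1,2) common_topD[OF F(4)] T(3) by meson
      then have U: "F \<union> G - {v} = {0,1,2}"
        by blast
      have "{0,1,2} \<in> spanned T"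
        by (simp add: T_def spanned_iff)
      moreover have "e \<in> spanned T" if "e \<subseteq> {0,1,2}" for e
        using that by (auto simp: T_def spanned_iff)
      ultimately show "local_cond Mid (spanned T) F G v"
        unfolding local_cond.simps U F(3) by (auto intro!: bexI[of _ "{0,1,2}"])
    qed (use T FG in auto)
    then show "local_cond (kind (Skeleton Mid)) (spanned T) F G v"
      by simp
  next
    show "\<Union>T \<subseteq> fst ` W"
      by (simp add: T_def W_def)
    show "\<forall>(v, F, G)\<in>W. F \<in> T \<and> G \<in> T \<and> v \<in> F \<and> v \<in> G \<and> \<not> F \<subseteq> G \<and>
        card F = 3 \<and> card G = 3 \<and>
        {1,2,3} \<subseteq> F \<union> G"
      by (simp add: W_def T_def)
  next
    fix F G :: "nat set" and v
    assume "card F = 3" "{1,2,3} \<subseteq> F \<union> G"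
    moreover have "card {1,2,3::nat} = 3"
      by simp
    ultimately show "\<not> local_cond EC (spanned T) F G v"
      using missing unfolding local_cond.simps by metis
  qed simp
qed

lemma Skeleton_Weakly_not_Facet_Mid:
  assumes "2 \<le> d"
  shows "separated d (Skeleton Weakly) (Facet Mid)"
proof -
  \<comment> \<open>The triangles 024, 012, 013, 134 form a strip, each sharing an edge with the
    next, whose two ends meet in vertex 4; the edge 23 completes the graph.\<close>
  define T :: "nat set set" where "T = {{0,1,2}, {0,1,3}, {0,2,4}, {1,3,4}, {2,3}}"
  \<comment> \<open>At the vertices 0 to 3, dropping \<open>v\<close> from the union of the two
    triangles leaves a three-element non-face. At 4 it leaves \<open>{0,1,2,3}\<close>, where the
    edge 23 lies in no triangle.\<close>
  define W :: "(nat \<times> nat set \<times> nat set) set" where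
    "W = {(0, {0,1,2}, {0,1,3}), (1, {0,1,2}, {0,1,3}), (2, {0,1,2}, {0,2,4}),
      (3, {0,1,3}, {1,3,4}), (4, {0,2,4}, {1,3,4})}"
  have T: "finite T" "\<Union>T = {..<5}" "\<forall>t\<in>T. finite t \<and> card t \<le> 3"
    by (auto simp: T_def)
  show ?thesis
  proof (rule separated_trianglesI[OF T assms, where W = W and
        R = "\<lambda>F G v. \<exists>x\<in>F. \<exists>y\<in>G. x \<noteq> y \<and> x \<noteq> v \<and> y \<noteq> v \<and>
          (\<forall>H\<in>T. card H = 3 \<and> x \<in> H \<and> y \<in> H \<longrightarrow> \<not> H \<subseteq> F \<union> G - {v})"])
    fix F G v
    assume FG: "F \<in> range_faces (Skeleton Weakly) (spanned T)"
        "G \<in> range_faces (Skeleton Weakly) (spanned T)"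
      and top: "common_top Suc F G v"
    have "local_cond Weakly (spanned T) F G v"
    proof (rule local_cond_complete_graph[OF T(1) _ _ _ _ _ top])
      show "{x, y} \<in> spanned T" if "x \<in> \<Union>T" "y \<in> \<Union>T" for x y
        using that by (auto simp: T_def spanned_iff)
      fix F G v
      assume F: "F \<in> T" "G \<in> T" "card F = 3" "common_top Suc F G v"
      \<comment> \<open>The triangles 024 and 134 are the only ones with a common top. The size
        conditions exclude the edge 23, which shares its top with 013.\<close>
      have "\<forall>F\<in>T. \<forall>G\<in>T. \<forall>v\<in>F. v \<in> G \<and> (\<forall>w\<in>F \<union> G. w \<le> v) \<and> \<not> F \<subseteq> G \<and>
          card F = 3 \<and> card G = 3 \<longrightarrow> {0,1,2} \<subseteq> F \<union> G - {v}"
        by (simp add: T_def)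
      moreover have "card G = 3"
        using F(3,4) by (simp add: common_top_def)
      ultimately have "{0,1,2} \<subseteq> F \<union> G - {v}"
        using F(1-3) common_topD[OF F(4)] T(3) by meson
      moreover have "{0,1,2} \<in> spanned T"
        by (simp add: T_def spanned_iff)
      ultimately show "local_cond Weakly (spanned T) F G v"
        using F(3) by (auto intro!: bexI[of _ "{0,1,2}"])
    qed (use T FG in auto)
    then show "local_cond (kind (Skeleton Weakly)) (spanned T) F G v"
      by simp
  next
    show "\<Union>T \<subseteq> fst ` W"
      by (simp add: T_def W_def)
    show "\<forall>(v, F, G)\<in>W. F \<in> T \<and> G \<in> T \<and> v \<in> F \<and> v \<in> G \<and> \<not> F \<subseteq> G \<and>
        card F = 3 \<and> card G = 3 \<and>
        (\<exists>x\<in>F. \<exists>y\<in>G. x \<noteq> y \<and> x \<noteq> v \<and> y \<noteq> v \<and>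
          (\<forall>H\<in>T. card H = 3 \<and> x \<in> H \<and> y \<in> H \<longrightarrow> \<not> H \<subseteq> F \<union> G - {v}))"
      by (simp add: W_def T_def)
  next
    show "\<not> local_cond Mid (spanned T) F G v"
      if "card F = 3" "\<exists>x\<in>F. \<exists>y\<in>G. x \<noteq> y \<and> x \<noteq> v \<and> y \<noteq> v \<and>
          (\<forall>H\<in>T. card H = 3 \<and> x \<in> H \<and> y \<in> H \<longrightarrow> \<not> H \<subseteq> F \<union> G - {v})" for F G v
      using that T(3) not_local_Mid[of T F] by blast
  qed simp
qed

lemma Skeleton_Very_Weakly_not_Facet_Weakly:
  assumes "2 \<le> d"
  shows "separated d (Skeleton Very_Weakly) (Facet Weakly)"
proof -
  \<comment> \<open>The Pasch configuration: any two triangles share exactly one vertex.\<close>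
  define T :: "nat set set" where
    "T = {{0,1,2}, {0,3,4}, {1,3,5}, {2,4,5}, {0,5}, {1,4}, {2,3}}"
  \<comment> \<open>Each point lies on exactly two triangles, which are listed here. The other two
    triangles contain the sixth point, outside \<open>F \<union> G\<close>, so no triangle lies in
    \<open>F \<union> G - {v}\<close>.\<close>
  define W :: "(nat \<times> nat set \<times> nat set) set" where
    "W = {(0, {0,1,2}, {0,3,4}), (1, {0,1,2}, {1,3,5}), (2, {0,1,2}, {2,4,5}),
      (3, {0,3,4}, {1,3,5}), (4, {0,3,4}, {2,4,5}), (5, {1,3,5}, {2,4,5})}"
  have T: "finite T" "\<Union>T = {..<6}" "\<forall>t\<in>T. finite t \<and> card t \<le> 3"
    by (auto simp: T_def)
  show ?thesis
  proof (rule separated_trianglesI[OF T assms, where W = W and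
        R = "\<lambda>F G v. \<forall>H\<in>T. card H = 3 \<longrightarrow> \<not> H \<subseteq> F \<union> G - {v}"])
    fix F G v
    assume FG: "F \<in> range_faces (Skeleton Very_Weakly) (spanned T)"
        "G \<in> range_faces (Skeleton Very_Weakly) (spanned T)"
      and top: "common_top Suc F G v"
    have "local_cond Very_Weakly (spanned T) F G v"
    proof (rule local_cond_complete_graph[OF T(1) _ _ _ _ _ top])
      \<comment> \<open>The three edges in \<open>T\<close> join the pairs of points that lie on no
        common triangle.\<close>
      show "{x, y} \<in> spanned T" if "x \<in> \<Union>T" "y \<in> \<Union>T" for x y
        using that by (auto simp: T_def spanned_iff)
      fix F G v
      assume F: "F \<in> T" "G \<in> T" "card F = 3" "common_top Suc F G v"
      then have "F \<noteq> G" "card G = 3"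
        by (auto simp: common_top_def)
      moreover have "\<forall>F\<in>T. \<forall>G\<in>T. card F = 3 \<and> card G = 3 \<longrightarrow> F = G \<or> card (F \<inter> G) \<noteq> 2"
        by (simp add: T_def)
      ultimately have "card (F \<inter> G) \<noteq> 2"
        using F by blast
      then show "local_cond Very_Weakly (spanned T) F G v"
        using F(3) by (auto simp: adjacent_def face_dim_def)
    qed (use T FG in auto)
    then show "local_cond (kind (Skeleton Very_Weakly)) (spanned T) F G v"
      by simp
  next
    show "\<Union>T \<subseteq> fst ` W"
      by (simp add: T_def W_def)
    show "\<forall>(v, F, G)\<in>W. F \<in> T \<and> G \<in> T \<and> v \<in> F \<and> v \<in> G \<and> \<not> F \<subseteq> G \<and>
        card F = 3 \<and> card G = 3 \<and>
        (\<forall>H\<in>T. card H = 3 \<longrightarrow> \<not> H \<subseteq> F \<union> G - {v})"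
      by (simp add: W_def T_def)
  next
    show "\<not> local_cond Weakly (spanned T) F G v"
      if "card F = 3" "\<forall>H\<in>T. card H = 3 \<longrightarrow> \<not> H \<subseteq> F \<union> G - {v}" for F G v
      using that T(3) not_local_Weakly[of T F] by blast
  qed simp
qed

lemma Skeleton_Clique_not_Facet_Very_Weakly:
  assumes "2 \<le> d"
  shows "separated d (Skeleton Clique) (Facet Very_Weakly)"
proof -
  \<comment> \<open>The 5-vertex triangulation of the Moebius band, whose 1-skeleton is complete.\<close>
  define T :: "nat set set" where "T = {{0,1,2}, {1,2,3}, {2,3,4}, {0,3,4}, {0,1,4}}"
  \<comment> \<open>The triangles are \<open>{i, i+1, i+2}\<close> modulo 5. At \<open>v\<close> the
    two triangles cover \<open>v-1\<close> to \<open>v+2\<close>, and dropping \<open>v\<close>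
    leaves three vertices that are not consecutive.\<close>
  define W :: "(nat \<times> nat set \<times> nat set) set" where
    "W = {(0, {0,1,2}, {0,1,4}), (1, {1,2,3}, {0,1,2}), (2, {2,3,4}, {1,2,3}),
      (3, {0,3,4}, {2,3,4}), (4, {0,1,4}, {0,3,4})}"
  have T: "finite T" "\<Union>T = {..<5}" "\<forall>t\<in>T. finite t \<and> card t \<le> 3"
    by (auto simp: T_def)
  have pairs: "{x, y} \<in> spanned T" if "x \<in> \<Union>T" "y \<in> \<Union>T" for x y
    using that by (auto simp: T_def spanned_iff)
  show ?thesis
  proof (rule separated_trianglesI[OF T assms, where W = W and
        R = "\<lambda>F G v. card (F \<inter> G) = 2 \<and> F \<union> G - {v} \<notin> spanned T"])
    fix F G v
    assume "F \<in> range_faces (Skeleton Clique) (spanned T)"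
        "G \<in> range_faces (Skeleton Clique) (spanned T)"
    then have "F \<union> G \<subseteq> \<Union>T"
      by (auto simp: spanned_iff)
    then have edge: "{x, y} \<in> spanned T" if "{x, y} \<subseteq> F \<union> G" for x y
      using that by (intro pairs) blast+
    show "local_cond (kind (Skeleton Clique)) (spanned T) F G v"
      unfolding kind.simps local_cond.simps
    proof (intro allI impI)
      fix e assume e: "e \<subseteq> F \<union> G \<and> card e = 2"
      then obtain x y where "e = {x, y}"
        by (auto simp: card_2_iff)
      with e edge show "e \<in> spanned T"
        by simp
    qed
  next
    show "\<Union>T \<subseteq> fst ` W"
      by (simp add: T_def W_def)
    show "\<forall>(v, F, G)\<in>W. F \<in> T \<and> G \<in> T \<and> v \<in> F \<and> v \<in> G \<and> \<not> F \<subseteq> G \<and>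
        card F = 3 \<and> card G = 3 \<and>
        card (F \<inter> G) = 2 \<and> F \<union> G - {v} \<notin> spanned T"
      by (simp add: W_def T_def spanned_iff insert_Diff_if)
  next
    show "\<not> local_cond Very_Weakly (spanned T) F G v"
      if "card F = 3" "card G = 3" "card (F \<inter> G) = 2 \<and> F \<union> G - {v} \<notin> spanned T" for F G v
      using that by (simp add: adjacent_def face_dim_def)
  qed simp
qed

text \<open>The graph of the complex below lacks just the edges 14, 15 and 23, and every vertex is
  shared by two triangles whose union contains one of these pairs.\<close>

lemma Facet_Weakly_not_Facet_Clique:
  assumes "2 \<le> d"
  shows "separated d (Facet Weakly) (Facet Clique)"
proof -
  define T :: "nat set set" where "T = {{0,1,2}, {0,1,3}, {0,2,4}, {0,2,5}, {3,4,5}}"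
  define W :: "(nat \<times> nat set \<times> nat set) set" where
    "W = {(0, {0,2,5}, {0,1,3}), (1, {0,1,3}, {0,1,2}), (2, {0,2,5}, {0,1,2}),
      (3, {0,1,3}, {3,4,5}), (4, {0,2,4}, {3,4,5}), (5, {0,2,5}, {3,4,5})}"
  have T: "finite T" "\<Union>T = {..<6}" "\<forall>t\<in>T. finite t \<and> card t \<le> 3"
    by (auto simp: T_def)
  show ?thesis
  proof (rule separated_trianglesI[OF T assms, where W = W and
        R = "\<lambda>F G v. \<exists>x\<in>F. \<exists>y\<in>G. x \<noteq> y \<and> {x, y} \<notin> spanned T"])
    fix F G v
    assume "F \<in> range_faces (Facet Weakly) (spanned T)" "G \<in> range_faces (Facet Weakly) (spanned T)"
      and top: "common_top Suc F G v"
    then have F: "F \<in> T" "G \<in> T"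
      using facets_spanned_subset by auto
    \<comment> \<open>Only 025 and 345 share their top, namely 5, and the rest of their union
      contains the triangle 024.\<close>
    have "\<forall>F\<in>T. \<forall>G\<in>T. \<forall>v\<in>F. v \<in> G \<and> (\<forall>w\<in>F \<union> G. w \<le> v) \<and> \<not> F \<subseteq> G \<longrightarrow>
        {0,2,4} \<subseteq> F \<union> G - {v}"
      by (simp add: T_def)
    then have "{0,2,4} \<subseteq> F \<union> G - {v}"
      using F common_topD[OF top] T(3) by meson
    moreover have "{0,2,4} \<in> spanned T"
      by (simp add: T_def spanned_iff)
    moreover have "card F = 3"
      using F by (auto simp: T_def)
    ultimately show "local_cond (kind (Facet Weakly)) (spanned T) F G v"
      by (auto intro!: bexI[of _ "{0,2,4}"])
  next
    show "\<Union>T \<subseteq> fst ` W"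
      by (simp add: T_def W_def)
    show "\<forall>(v, F, G)\<in>W. F \<in> T \<and> G \<in> T \<and> v \<in> F \<and> v \<in> G \<and> \<not> F \<subseteq> G \<and>
        card F = 3 \<and> card G = 3 \<and>
        (\<exists>x\<in>F. \<exists>y\<in>G. x \<noteq> y \<and> {x, y} \<notin> spanned T)"
      by (simp add: W_def T_def spanned_iff)
  next
    show "\<not> local_cond Clique (spanned T) F G v"
      if "\<exists>x\<in>F. \<exists>y\<in>G. x \<noteq> y \<and> {x, y} \<notin> spanned T" for F G v
      using that by (elim bexE conjE) (rule not_local_Clique)
  qed simp
qed

section \<open>From six separations to all pairs\<close>

lemma reachable_implication_holds:
  assumes K: "abstract_complex K" and P: "has_property P K" and PQ: "(P, Q) \<in> listed_implications\<^sup>*"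
  shows "has_property Q K"
  using PQ by induction (use P listed_implication_holds[OF K] in auto)

text \<open>A complex with \<open>P\<close> but not \<open>Q\<close> has everything that
  \<open>P\<close> implies and lacks everything that implies \<open>Q\<close>.\<close>

lemma separated_mono:
  assumes "separated d P Q" "(P, P') \<in> listed_implications\<^sup>*" "(Q', Q) \<in> listed_implications\<^sup>*"
  shows "separated d P' Q'"
  using assms reachable_implication_holds unfolding separated_def by blast

lemma implied_or_separated:
  assumes d: "2 \<le> d"
  shows "(P, Q) \<in> listed_implications\<^sup>* \<or> separated d P Q"
proof -
  let ?L = "listed_implications\<^sup>*"
  have step: "(Skeleton EC, Skeleton Mid) \<in> ?L" "(Skeleton Mid, Skeleton Weakly) \<in> ?L"
    "(Skeleton Weakly, Skeleton Very_Weakly) \<in> ?L" "(Skeleton Very_Weakly, Skeleton Clique) \<in> ?L"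
    "(Facet EC, Facet Mid) \<in> ?L" "(Facet Mid, Facet Weakly) \<in> ?L"
    "(Facet Weakly, Facet Very_Weakly) \<in> ?L" "(Facet Mid, Facet Clique) \<in> ?L"
    "(Skeleton X, Facet X) \<in> ?L" "(R, R) \<in> ?L" for X R
    by (auto simp: listed_implications_def intro: r_into_rtrancl)
  note trans = rtrancl_trans
  have more: "(Skeleton EC, Skeleton Weakly) \<in> ?L" "(Skeleton EC, Skeleton Very_Weakly) \<in> ?L"
    "(Skeleton EC, Skeleton Clique) \<in> ?L" "(Skeleton Mid, Skeleton Very_Weakly) \<in> ?L"
    "(Skeleton Mid, Skeleton Clique) \<in> ?L" "(Skeleton Weakly, Skeleton Clique) \<in> ?L"
    "(Facet EC, Facet Weakly) \<in> ?L" "(Facet EC, Facet Very_Weakly) \<in> ?L"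
    "(Facet EC, Facet Clique) \<in> ?L" "(Facet Mid, Facet Very_Weakly) \<in> ?L"
    using step(1-8) by (meson trans)+
  have cross: "(Skeleton X, Facet Y) \<in> ?L" if "(Skeleton X, Skeleton Y) \<in> ?L" for X Y
    using that step(9) by (rule trans)
  note implied = step more step(1-4)[THEN cross] more(1-6)[THEN cross]
  \<comment> \<open>Each line spreads one of the six base separations: forward from its first
    property and backward from its second.\<close>
  have separated:
    "\<forall>X Y. separated d (Facet X) (Skeleton Y)"
    "\<forall>P\<in>{Skeleton Mid, Skeleton Weakly, Skeleton Very_Weakly, Skeleton Clique,
          Facet Mid, Facet Weakly, Facet Very_Weakly, Facet Clique}.
      \<forall>Q\<in>{Facet EC, Skeleton EC}. separated d P Q"
    "\<forall>P\<in>{Skeleton Weakly, Skeleton Very_Weakly, Skeleton Clique,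
          Facet Weakly, Facet Very_Weakly, Facet Clique}.
      \<forall>Q\<in>{Facet Mid, Skeleton Mid}. separated d P Q"
    "\<forall>P\<in>{Skeleton Very_Weakly, Skeleton Clique, Facet Very_Weakly, Facet Clique}.
      \<forall>Q\<in>{Facet Weakly, Skeleton Weakly}. separated d P Q"
    "\<forall>P\<in>{Skeleton Clique, Facet Clique}.
      \<forall>Q\<in>{Facet Very_Weakly, Skeleton Very_Weakly}. separated d P Q"
    "\<forall>P\<in>{Facet Weakly, Facet Very_Weakly}. separated d P (Facet Clique)"
    subgoal
    proof (intro allI)
      fix X Y
      show "separated d (Facet X) (Skeleton Y)"
        by (rule separated_mono[OF Facet_EC_not_Skeleton_Clique[OF d]];
            cases X; cases Y; simp add: implied)
    qed
    subgoal
      by (intro ballI separated_mono[OF Skeleton_Mid_not_Facet_EC[OF d]]) (auto simp: implied)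
    subgoal
      by (intro ballI separated_mono[OF Skeleton_Weakly_not_Facet_Mid[OF d]]) (auto simp: implied)
    subgoal
      by (intro ballI separated_mono[OF Skeleton_Very_Weakly_not_Facet_Weakly[OF d]])
        (auto simp: implied)
    subgoal
      by (intro ballI separated_mono[OF Skeleton_Clique_not_Facet_Very_Weakly[OF d]])
        (auto simp: implied)
    subgoal
      by (intro ballI separated_mono[OF Facet_Weakly_not_Facet_Clique[OF d]]) (auto simp: implied)
    done
  show ?thesis
  proof (cases P; cases Q)
    fix X Y assume "P = Facet X" "Q = Facet Y"
    then show ?thesis
      by (cases X; cases Y; simp add: implied separated)
  next
    fix X Y assume "P = Facet X" "Q = Skeleton Y"
    then show ?thesis
      by (simp add: separated(1))
  next
    fix X Y assume "P = Skeleton X" "Q = Facet Y"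
    then show ?thesis
      by (cases X; cases Y; simp add: implied separated)
  next
    fix X Y assume "P = Skeleton X" "Q = Skeleton Y"
    then show ?thesis
      by (cases X; cases Y; simp add: implied separated)
  qed
qed

theorem theorem15:
  shows "(\<forall>(P, Q) \<in> listed_implications. \<forall>K :: 'a set set.
            abstract_complex K \<and> has_property P K \<longrightarrow> has_property Q K)
       \<and> (\<forall>d :: nat. d \<ge> 2 \<longrightarrow>
            (\<forall>P Q. P \<noteq> Q \<and> (P, Q) \<notin> listed_implications\<^sup>+ \<longrightarrow>
              (\<exists>K :: nat set set. abstract_complex K \<and> complex_dim K = int d
                 \<and> has_property P K \<and> \<not> has_property Q K)))"
proof (intro conjI allI impI)
  show "\<forall>(P, Q) \<in> listed_implications. \<forall>K :: 'a set set.
      abstract_complex K \<and> has_property P K \<longrightarrow> has_property Q K"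
    using listed_implication_holds by blast
next
  fix d :: nat and P Q
  assume "2 \<le> d" "P \<noteq> Q \<and> (P, Q) \<notin> listed_implications\<^sup>+"
  \<comment> \<open>For \<open>P \<noteq> Q\<close> the transitive and the reflexive-transitive
    closure agree, which rules out the first alternative of
    \<open>implied_or_separated\<close>.\<close>
  then have "separated d P Q"
    using implied_or_separated by (metis rtranclD)
  then show "\<exists>K :: nat set set. abstract_complex K \<and> complex_dim K = int d
      \<and> has_property P K \<and> \<not> has_property Q K"
    by (simp add: separated_def)
qed

end
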